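(* Let $A,B\in M_{n\times n}(\mathbb{C})$ be two self-adjoint matrices that commute. Then for $1\leq p\leq 2$ $$\|\sigma_\downarrow(A)+\sigma_\downarrow(B)\|_p^p+\|\sigma_\downarrow(A)-\sigma_\downarrow(B)\|_p^p\;\leq\; \|A+B\|_p^p+\|A-B\|_p^p\;\leq\; \|\sigma_\uparrow(A)+\sigma_{\downarrow}(B)\|_p^p+\|\sigma_\uparrow(A)-\sigma_{\downarrow}(B)\|_p^p,$$ and for $2\leq p<\infty$ both inequalities are reversed. Furthermore, for $p\neq 1,2$ there is equality in the left (respectively right) inequality if and only if $A$ and $B$ are aligned in the corresponding extremized arrangement, i.e. if and only if there is an orthonormal basis simultaneously diagonalizing $A$ and $B$ in which the vectors of absolute values of the diagonal entries of $A$ and of $B$ are $\sigma_\downarrow(A)$ and $\sigma_\downarrow(B)$ (respectively $\sigma_\uparrow(A)$ and $\sigma_\downarrow(B)$).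
   Context: For a matrix $X\in M_{n\times n}(\mathbb{C})$, $\|X\|_p=\operatorname{Tr}[(X^*X)^{p/2}]^{1/p}$ is the $p$-Schatten norm; for a vector $v\in\mathbb{R}^n$, $\|v\|_p=(\sum_i|v_i|^p)^{1/p}$. $\sigma_\downarrow(X)$ and $\sigma_\uparrow(X)$ denote the vectors in $\mathbb{R}^n$ of singular values of $X$ (with multiplicity) in decreasing and increasing order respectively. The range of $p$ is $1\le p<\infty$. *)

theory Defs
  imports "Jordan_Normal_Form.Schur_Decomposition" "HOL-Library.Multiset" Complex_Main
begin

definition self_adjoint_mat :: "complex mat \<Rightarrow> bool" where
  "self_adjoint_mat A \<longleftrightarrow> mat_adjoint A = A"

text \<open>The columns of a unitary matrix are an orthonormal basis, and every orthonormal basis of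
  the coordinate space arises in this way.\<close>

definition unitary_mat :: "nat \<Rightarrow> complex mat \<Rightarrow> bool" where
  "unitary_mat n U \<longleftrightarrow> U \<in> carrier_mat n n \<and> mat_adjoint U * U = 1\<^sub>m n"

definition trace_mat :: "'a :: comm_monoid_add mat \<Rightarrow> 'a" where
  "trace_mat A = (\<Sum>i<dim_row A. A $$ (i, i))"

text \<open>Real powers of a positive semidefinite matrix by functional calculus: if $P = U D U^*$ with
  $U$ unitary and $D$ diagonal with nonnegative entries, then $P^r = U D^r U^*$, which does not
  depend on the choice of $U$ and $D$. The convention \<open>0 powr r = 0\<close> applies to zero
  eigenvalues, as it should for $r > 0$. The value is unspecified for other matrices.\<close>

definition psd_powr :: "complex mat \<Rightarrow> real \<Rightarrow> complex mat" where
  "psd_powr P r = (THE Q. \<exists>U d. unitary_mat (dim_row P) U \<and> (\<forall>i<dim_row P. 0 \<le> d i) \<and>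
     P = U * mat_diag (dim_row P) (\<lambda>i. complex_of_real (d i)) * mat_adjoint U \<and>
     Q = U * mat_diag (dim_row P) (\<lambda>i. complex_of_real (d i powr r)) * mat_adjoint U)"

text \<open>The trace below is a nonnegative real number, so taking the real part loses nothing.\<close>

definition schatten_norm :: "real \<Rightarrow> complex mat \<Rightarrow> real" where
  "schatten_norm p X = Re (trace_mat (psd_powr (mat_adjoint X * X) (p / 2))) powr (1 / p)"

definition lp_norm :: "real \<Rightarrow> real vec \<Rightarrow> real" where
  "lp_norm p v = (\<Sum>i<dim_vec v. \<bar>v $ i\<bar> powr p) powr (1 / p)"

text \<open>Singular values are the square roots of the eigenvalues of $X^* X$. These eigenvalues are
  real and nonnegative, and their multiplicities are those of the roots of the characteristic
  polynomial.\<close>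

definition singular_values :: "complex mat \<Rightarrow> real multiset" where
  "singular_values X = image_mset (\<lambda>z. sqrt (Re z)) (proots (char_poly (mat_adjoint X * X)))"

definition sigma_up :: "complex mat \<Rightarrow> real vec"  (\<open>\<sigma>\<^sub>\<up>\<close>) where
  "\<sigma>\<^sub>\<up> X = vec_of_list (sorted_list_of_multiset (singular_values X))"

definition sigma_down :: "complex mat \<Rightarrow> real vec"  (\<open>\<sigma>\<^sub>\<down>\<close>) where
  "\<sigma>\<^sub>\<down> X = vec_of_list (rev (sorted_list_of_multiset (singular_values X)))"

text \<open>Some orthonormal basis (the columns of \<open>U\<close>) diagonalizes \<open>A\<close> and \<open>B\<close> simultaneously, with
  absolute values of the diagonal entries given, in order, by \<open>s\<close> and \<open>t\<close>.\<close>

definition simultaneously_aligned ::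
  "nat \<Rightarrow> complex mat \<Rightarrow> complex mat \<Rightarrow> real vec \<Rightarrow> real vec \<Rightarrow> bool" where
  "simultaneously_aligned n A B s t \<longleftrightarrow> (\<exists>U. unitary_mat n U \<and>
     diagonal_mat (mat_adjoint U * A * U) \<and> diagonal_mat (mat_adjoint U * B * U) \<and>
     vec n (\<lambda>i. cmod ((mat_adjoint U * A * U) $$ (i, i))) = s \<and>
     vec n (\<lambda>i. cmod ((mat_adjoint U * B * U) $$ (i, i))) = t)"

end

theory Submission
  imports Defs "Jordan_Normal_Form.Spectral_Radius"
begin

text \<open>In a common eigenbasis the middle term becomes the sum of \<open>f(|a\<^sub>i|, |b\<^sub>i|)\<close> with
  \<open>f(x, y) = |x + y|\<^sup>p + |x - y|\<^sup>p\<close>. On the nonnegative quadrant \<open>f\<close> is submodular for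
  \<open>p \<le> 2\<close> and supermodular for \<open>p \<ge> 2\<close>, strictly if \<open>p \<noteq> 1, 2\<close>, so the rearrangement inequality
  for such functions gives both bounds. Strictness makes equality force the multiset of pairs
  \<open>(|a\<^sub>i|, |b\<^sub>i|)\<close> to be the extremal one, and then permuting the eigenbasis aligns the two
  matrices.\<close>

section \<open>The exchange inequality\<close>

text \<open>For p > 1 and x, y > 0 off the diagonal, the mixed derivative of f is p (p - 1) (|x +
  y|^(p - 2) - |x - y|^(p - 2)). It has the sign of p - 2 because |x - y| < x + y. For p < 2 it
  blows up at x = y, which shapes the calculus part: the first derivative in y, built from sgn t *
  |t|^(p - 1), is shown to be monotone in x on either side of the diagonal, and the pieces are
  joined by continuity. At p = 1 the first derivative breaks down on the diagonal, at p = 2 the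
  mixed one vanishes; these two exponents are treated directly, and there strictness is lost. Signs
  of eigenvalues do no harm: changing the sign of a or b only swaps |a + b| and |a - b|. In the
  equality statement the aligning basis need not be the common eigenbasis chosen at the start, so
  the middle term is evaluated in an arbitrary one.\<close>

lemma DERIV_abs_powr:
  fixes p t :: real
  assumes "1 < p"
  shows "((\<lambda>t. \<bar>t\<bar> powr p) has_real_derivative p * (sgn t * \<bar>t\<bar> powr (p - 1))) (at t)"
proof -
  consider "0 < t" | "t < 0" | "t = 0" by linarith
  then show ?thesis
  proof cases
    case 1
    have "((\<lambda>t. t powr p) has_real_derivative p * t powr (p - 1)) (at t)"
      using 1 by (rule has_real_derivative_powr)
    then show ?thesis
      by (rule DERIV_cong[OF DERIV_cong_ev[OF refl _ refl, THEN iffD2, rotated]])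
         (use 1 in \<open>auto intro: eventually_mono[OF eventually_nhds_in_open[of "{0<..}"]]\<close>)
  next
    case 2
    have "((\<lambda>t. (- t) powr p) has_real_derivative p * (- t) powr (p - 1) * (- 1)) (at t)"
      using 2 by (auto intro!: derivative_eq_intros simp: powr_diff field_simps)
    then show ?thesis
      by (rule DERIV_cong[OF DERIV_cong_ev[OF refl _ refl, THEN iffD2, rotated]])
         (use 2 in \<open>auto intro: eventually_mono[OF eventually_nhds_in_open[of "{..<0}"]]\<close>)
  next
    case 3
    \<comment> \<open>At 0 the difference quotient has absolute value |h|^(p - 1), which tends to 0
      exactly because p > 1; \<open>sgn 0 = 0\<close> makes the general formula agree.\<close>
    have "((\<lambda>h. \<bar>h\<bar> powr (p - 1)) \<longlongrightarrow> 0) (at (0::real))"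
      using assms by (auto intro!: tendsto_eq_intros)
    moreover have "\<forall>\<^sub>F h in at (0::real). \<bar>h\<bar> powr (p - 1) = \<bar>\<bar>h\<bar> powr p / h\<bar>"
      by (auto simp: eventually_at_filter powr_diff)
    ultimately have "((\<lambda>h. \<bar>\<bar>h\<bar> powr p / h\<bar>) \<longlongrightarrow> 0) (at (0::real))"
      by (rule Lim_transform_eventually)
    then have "((\<lambda>h. \<bar>h\<bar> powr p / h) \<longlongrightarrow> 0) (at (0::real))"
      by (rule tendsto_rabs_zero_cancel)
    then show ?thesis
      using 3 by (simp add: DERIV_def)
  qed
qed

text \<open>The point 0 is excluded because for q < 1 the graph has a vertical tangent there. With q
  = p - 1 this is the singularity on the diagonal x = y.\<close>

lemma DERIV_sgn_powr:
  fixes q t :: real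
  assumes "t \<noteq> 0"
  shows "((\<lambda>t. sgn t * \<bar>t\<bar> powr q) has_real_derivative q * \<bar>t\<bar> powr (q - 1)) (at t)"
proof (cases "0 < t")
  case True
  have "((\<lambda>t. t powr q) has_real_derivative q * t powr (q - 1)) (at t)"
    using True by (rule has_real_derivative_powr)
  then show ?thesis
    by (rule DERIV_cong[OF DERIV_cong_ev[OF refl _ refl, THEN iffD2, rotated]])
       (use True in \<open>auto intro: eventually_mono[OF eventually_nhds_in_open[of "{0<..}"]]\<close>)
next
  case False
  have "((\<lambda>t. - ((- t) powr q)) has_real_derivative q * (- t) powr (q - 1)) (at t)"
    using False assms by (auto intro!: derivative_eq_intros simp: powr_diff field_simps)
  then show ?thesis
    by (rule DERIV_cong[OF DERIV_cong_ev[OF refl _ refl, THEN iffD2, rotated]])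
       (use False assms in \<open>auto intro: eventually_mono[OF eventually_nhds_in_open[of "{..<0}"]]\<close>)
qed

lemma continuous_on_sgn_powr:
  fixes f :: "'a::topological_space \<Rightarrow> real"
  assumes "0 < q" "continuous_on S f"
  shows "continuous_on S (\<lambda>x. sgn (f x) * \<bar>f x\<bar> powr q)"
proof -
  \<comment> \<open>\<open>sgn\<close> jumps at 0, so continuity does not follow factor by factor.
    Powers of the positive and negative parts are continuous since q > 0.\<close>
  have "sgn t * \<bar>t\<bar> powr q = max t 0 powr q - max (- t) 0 powr q" for t :: real
    by (simp add: max_def sgn_if)
  moreover have "continuous_on S (\<lambda>x. max (f x) 0 powr q - max (- f x) 0 powr q)"
    using assms by (intro continuous_intros continuous_on_powr') auto
  ultimately show ?thesis by simp
qed

text \<open>The factor \<open>1 - q\<close> (in the next lemma \<open>2 - p\<close>) absorbs the change of sign at the critical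
  exponent.\<close>

lemma sgn_powr_difference_monotone:
  fixes q x x' y :: real
  assumes q: "0 < q" "q \<noteq> 1" and y: "0 < y" and x: "0 \<le> x" "x < x'"
  defines "s \<equiv> \<lambda>t. sgn t * \<bar>t\<bar> powr q"
  shows "(1 - q) * (s (x' + y) - s (x' - y)) < (1 - q) * (s (x + y) - s (x - y))"
proof -
  let ?K = "\<lambda>x. (1 - q) * (s (x + y) - s (x - y))"
  let ?K' = "\<lambda>x. (1 - q) * (q * \<bar>x + y\<bar> powr (q - 1) - q * \<bar>x - y\<bar> powr (q - 1))"
  have s: "((\<lambda>x. s (x + c)) has_real_derivative q * \<bar>t + c\<bar> powr (q - 1)) (at t)"
    if "t + c \<noteq> 0" for t c
    using DERIV_shift[THEN iffD1, OF DERIV_sgn_powr[OF that, of q]] by (simp add: s_def)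
  have der: "(?K has_real_derivative ?K' t) (at t)" if "0 < t" "t \<noteq> y" for t
    using s[of t y] s[of t "- y"] that y by (intro DERIV_cmult DERIV_diff) auto
  have neg: "?K' t < 0" if "0 < t" "t \<noteq> y" for t
  proof -
    \<comment> \<open>The exponent q - 1 and the factor 1 - q have opposite signs, so the product is
      negative in both cases.\<close>
    have "\<bar>t - y\<bar> < \<bar>t + y\<bar>" "0 < \<bar>t - y\<bar>" using that y by auto
    then consider "q < 1" "\<bar>t + y\<bar> powr (q - 1) < \<bar>t - y\<bar> powr (q - 1)"
      | "1 < q" "\<bar>t - y\<bar> powr (q - 1) < \<bar>t + y\<bar> powr (q - 1)"
      using q powr_less_mono2[of "q - 1"] powr_less_mono2_neg[of "q - 1"]
      by (metis abs_ge_zero diff_gt_0_iff_gt diff_less_0_iff_less linorder_neqE_linordered_idom)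
    then show ?thesis
      by cases (use q in \<open>auto intro: mult_pos_neg mult_neg_pos\<close>)
  qed
  have cont: "continuous_on S ?K" for S
    unfolding s_def using q by (intro continuous_intros continuous_on_sgn_powr)
  \<comment> \<open>Differentiability may fail at y, so only intervals with y outside their interior
    are handled; an interval containing y inside is cut there.\<close>
  have dec: "?K b < ?K a" if "0 \<le> a" "a < b" "b \<le> y \<or> y \<le> a" for a b
  proof (rule DERIV_neg_imp_decreasing_open[OF \<open>a < b\<close> _ cont])
    fix t assume "a < t" "t < b"
    then have "0 < t" "t \<noteq> y" using that by auto
    then show "\<exists>D. (?K has_real_derivative D) (at t) \<and> D < 0"
      using der neg by blast
  qed
  show ?thesis
  proof (cases "x' \<le> y \<or> y \<le> x")
    case True
    then show ?thesis using dec[of x x'] x by auto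
  next
    case False
    have "?K x' < ?K y" by (rule dec) (use False y in auto)
    also have "?K y < ?K x" by (rule dec) (use False x in auto)
    finally show ?thesis .
  qed
qed

definition sum_diff_powr :: "real \<Rightarrow> real \<Rightarrow> real \<Rightarrow> real" where
  "sum_diff_powr p x y = \<bar>x + y\<bar> powr p + \<bar>x - y\<bar> powr p"

lemma sum_diff_powr_exchange:
  assumes p: "1 < p" "p \<noteq> 2" and x: "0 \<le> x" "x < x'" and y: "0 \<le> y" "y < y'"
  defines "f \<equiv> sum_diff_powr p"
  shows "(2 - p) * (f x y + f x' y') < (2 - p) * (f x y' + f x' y)"
proof -
  let ?s = "\<lambda>t. sgn t * \<bar>t\<bar> powr (p - 1)"
  let ?h = "\<lambda>y. (2 - p) * (f x' y - f x y)"
  let ?h' = "\<lambda>y. (2 - p) * (p * (?s (x' + y) - ?s (x' - y)) - p * (?s (x + y) - ?s (x - y)))"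
  have f: "(f u has_real_derivative p * (?s (u + t) - ?s (u - t))) (at t)" for u t
    unfolding f_def sum_diff_powr_def
    by (rule derivative_eq_intros DERIV_chain2[OF DERIV_abs_powr] p refl | simp add: algebra_simps)+
  have der: "(?h has_real_derivative ?h' t) (at t)" for t
    by (intro DERIV_cmult DERIV_diff f)
  have neg: "?h' t < 0" if "0 < t" for t
  proof -
    \<comment> \<open>The previous lemma with q = p - 1: its conditions on q become 1 < p and p
      \<noteq> 2, and 1 - q = 2 - p.\<close>
    have "(1 - (p - 1)) * (?s (x' + t) - ?s (x' - t)) < (1 - (p - 1)) * (?s (x + t) - ?s (x - t))"
      by (rule sgn_powr_difference_monotone) (use that p x in auto)
    then have "p * ((2 - p) * (?s (x' + t) - ?s (x' - t))) < p * ((2 - p) * (?s (x + t) - ?s (x - t)))"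
      using p by simp
    then show ?thesis by (simp add: algebra_simps)
  qed
  have "continuous_on {y..y'} ?h"
    using der by (meson DERIV_isCont continuous_at_imp_continuous_on)
  then have "?h y' < ?h y"
  proof (rule DERIV_neg_imp_decreasing_open[OF \<open>y < y'\<close>, rotated])
    fix t assume "y < t" "t < y'"
    then have "0 < t" using y by auto
    then show "\<exists>D. (?h has_real_derivative D) (at t) \<and> D < 0"
      using der neg by blast
  qed
  then show ?thesis by (simp add: algebra_simps)
qed

text \<open>Adds the exponents missing from the strict version. On nonnegative arguments the
  function is 2 max(x, y) for p = 1. For p = 2 it is 2 x^2 + 2 y^2, which splits into functions of x
  and of y, so an exchange changes nothing.\<close>

lemma sum_diff_powr_exchange_weak:
  assumes p: "1 \<le> p" and x: "0 \<le> x" "x < x'" and y: "0 \<le> y" "y < y'"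
  defines "f \<equiv> sum_diff_powr p"
  shows "p \<le> 2 \<Longrightarrow> f x y + f x' y' \<le> f x y' + f x' y"
    and "2 \<le> p \<Longrightarrow> f x y' + f x' y \<le> f x y + f x' y'"
proof -
  have 1: "f x y + f x' y' \<le> f x y' + f x' y" if "p = 1"
    using x y by (auto simp: f_def that sum_diff_powr_def)
  have 2: "f x y + f x' y' = f x y' + f x' y" if "p = 2"
    by (simp add: f_def that sum_diff_powr_def power2_eq_square algebra_simps)
  have 3: "(2 - p) * (f x y + f x' y') < (2 - p) * (f x y' + f x' y)" if "1 < p" "p \<noteq> 2"
    unfolding f_def by (rule sum_diff_powr_exchange) (use that x y in auto)
  show "f x y + f x' y' \<le> f x y' + f x' y" if "p \<le> 2"
    using 1 2 3 p that by (cases "p = 1"; cases "p = 2") auto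
  show "f x y' + f x' y \<le> f x y + f x' y'" if "2 \<le> p"
    using 2 3 p that by (cases "p = 2") auto
qed

section \<open>Rearrangement\<close>

text \<open>Relative to sets because \<open>sum_diff_powr\<close> is even in each argument, so its
  exchange inequality turns around between adjacent quadrants; the reflection used for
  \<open>antialigned\<close> also needs the negated set.\<close>

definition supermodular_on :: "'a::ord set \<Rightarrow> 'b::ord set \<Rightarrow> ('a \<Rightarrow> 'b \<Rightarrow> real) \<Rightarrow> bool" where
  "supermodular_on X Y f \<longleftrightarrow>
     (\<forall>s\<in>X. \<forall>x\<in>X. \<forall>t\<in>Y. \<forall>y\<in>Y. s < x \<longrightarrow> t < y \<longrightarrow> f s y + f x t \<le> f s t + f x y)"

definition strict_supermodular_on :: "'a::ord set \<Rightarrow> 'b::ord set \<Rightarrow> ('a \<Rightarrow> 'b \<Rightarrow> real) \<Rightarrow> bool" where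
  "strict_supermodular_on X Y f \<longleftrightarrow>
     (\<forall>s\<in>X. \<forall>x\<in>X. \<forall>t\<in>Y. \<forall>y\<in>Y. s < x \<longrightarrow> t < y \<longrightarrow> f s y + f x t < f s t + f x y)"

lemma supermodular_onD:
  "\<lbrakk>supermodular_on X Y f; s \<in> X; x \<in> X; t \<in> Y; y \<in> Y; s < x; t < y\<rbrakk>
    \<Longrightarrow> f s y + f x t \<le> f s t + f x y"
  by (auto simp: supermodular_on_def)

lemma strict_supermodular_onD:
  "\<lbrakk>strict_supermodular_on X Y f; s \<in> X; x \<in> X; t \<in> Y; y \<in> Y; s < x; t < y\<rbrakk>
    \<Longrightarrow> f s y + f x t < f s t + f x y"
  by (auto simp: strict_supermodular_on_def)

lemma strict_supermodular_on_imp_supermodular_on: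
  "strict_supermodular_on X Y f \<Longrightarrow> supermodular_on X Y f"
  unfolding supermodular_on_def strict_supermodular_on_def by (blast intro: less_imp_le)

text \<open>The comonotone coupling of the two marginals of \<open>Z\<close>;
  \<open>antialigned\<close> is the countermonotone one. As multisets of pairs they forget the
  numbering of the eigenbasis.\<close>

definition aligned :: "('a::linorder \<times> 'b::linorder) multiset \<Rightarrow> ('a \<times> 'b) multiset" where
  "aligned Z = mset (zip (sorted_list_of_multiset (image_mset fst Z))
                         (sorted_list_of_multiset (image_mset snd Z)))"

definition antialigned :: "('a::linorder \<times> 'b::linorder) multiset \<Rightarrow> ('a \<times> 'b) multiset" where
  "antialigned Z = mset (zip (sorted_list_of_multiset (image_mset fst Z))
                             (rev (sorted_list_of_multiset (image_mset snd Z))))"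

lemma sorted_list_of_multiset_unique:
  "sorted xs \<Longrightarrow> mset xs = X \<Longrightarrow> sorted_list_of_multiset X = xs"
  by (metis sorted_list_of_multiset_mset sorted_sort_id)

lemma length_sorted_list_of_multiset [simp]: "length (sorted_list_of_multiset X) = size X"
  by (metis mset_sorted_list_of_multiset size_mset)

lemma sorted_list_of_multiset_add_max:
  assumes "\<And>x. x \<in># X \<Longrightarrow> x \<le> m"
  shows "sorted_list_of_multiset (add_mset m X) = sorted_list_of_multiset X @ [m]"
  by (rule sorted_list_of_multiset_unique)
     (use assms in \<open>auto simp: sorted_append sorted_sorted_list_of_multiset\<close>)

lemma aligned_add_max:
  assumes "\<And>z. z \<in># Z \<Longrightarrow> fst z \<le> x \<and> snd z \<le> y"
  shows "aligned (add_mset (x, y) Z) = add_mset (x, y) (aligned Z)"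
proof -
  have "sorted_list_of_multiset (add_mset x (image_mset fst Z)) = sorted_list_of_multiset (image_mset fst Z) @ [x]"
    "sorted_list_of_multiset (add_mset y (image_mset snd Z)) = sorted_list_of_multiset (image_mset snd Z) @ [y]"
    by (rule sorted_list_of_multiset_add_max; use assms in auto)+
  then show ?thesis
    by (simp add: aligned_def del: sorted_list_of_multiset_insert)
qed

text \<open>If the largest first and second components occur in different pairs \<open>(x, t)\<close> and
  \<open>(s, y)\<close>, exchanging them to \<open>(x, y)\<close> and \<open>(s, t)\<close> increases the sum; the pair of maxima can
  then be split off.\<close>

lemma
  fixes Z :: "('a::linorder \<times> 'b::linorder) multiset"
  assumes "supermodular_on X Y f" "set_mset Z \<subseteq> X \<times> Y"
  shows sum_le_sum_aligned: "(\<Sum>(x, y)\<in>#Z. f x y) \<le> (\<Sum>(x, y)\<in>#aligned Z. f x y)"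
    and sum_less_sum_aligned: "\<lbrakk>strict_supermodular_on X Y f; Z \<noteq> aligned Z\<rbrakk>
      \<Longrightarrow> (\<Sum>(x, y)\<in>#Z. f x y) < (\<Sum>(x, y)\<in>#aligned Z. f x y)"
proof -
  let ?S = "\<lambda>Z. \<Sum>(x, y)\<in>#Z. f x y"
  have "?S Z \<le> ?S (aligned Z) \<and>
      (strict_supermodular_on X Y f \<longrightarrow> Z \<noteq> aligned Z \<longrightarrow> ?S Z < ?S (aligned Z))"
    using assms(2)
  \<comment> \<open>After an exchange the remaining pairs need not form a submultiset of
    \<open>Z\<close>, hence induction on the size.\<close>
  proof (induction "size Z" arbitrary: Z rule: less_induct)
    case less
    show ?case
    proof (cases "Z = {#}")
      case True
      then show ?thesis by (simp add: aligned_def)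
    next
      case False
      define x where "x = Max (fst ` set_mset Z)"
      define y where "y = Max (snd ` set_mset Z)"
      have max: "fst z \<le> x \<and> snd z \<le> y" if "z \<in># Z" for z
        using that by (simp add: x_def y_def)
      show ?thesis
      proof (cases "(x, y) \<in># Z")
        case True
        then obtain Z' where Z: "Z = add_mset (x, y) Z'"
          by (metis mset_add)
        have al: "aligned Z = add_mset (x, y) (aligned Z')"
          unfolding Z by (rule aligned_add_max) (use max Z in auto)
        show ?thesis
          using less.hyps[of Z'] less.prems unfolding al by (auto simp: Z)
      next
        case False
        have "x \<in> fst ` set_mset Z" "y \<in> snd ` set_mset Z"
          using \<open>Z \<noteq> {#}\<close> by (auto simp: x_def y_def intro!: Max_in)
        then obtain s t where st: "(x, t) \<in># Z" "(s, y) \<in># Z"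
          by force
        \<comment> \<open>Both inequalities are strict because the pair of maxima is absent from
          \<open>Z\<close>.\<close>
        with False max[of "(x, t)"] max[of "(s, y)"] have lt: "t < y" "s < x"
          by (auto simp: order.strict_iff_order)
        obtain Z1 where Z1: "Z = add_mset (x, t) Z1"
          using st(1) by (metis mset_add)
        then have "(s, y) \<in># Z1"
          using st(2) lt by auto
        then obtain Z' where Z: "Z = add_mset (x, t) (add_mset (s, y) Z')"
          unfolding Z1 by (metis mset_add)
        have mem: "s \<in> X" "x \<in> X" "t \<in> Y" "y \<in> Y"
          using less.prems by (auto simp: Z)
        let ?Z = "add_mset (s, t) Z'"
        \<comment> \<open>\<open>aligned\<close> depends only on the marginals, which the exchange
          preserves.\<close>
        have "aligned Z = aligned (add_mset (x, y) ?Z)"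
          by (simp add: aligned_def Z insort_left_comm)
        also have "\<dots> = add_mset (x, y) (aligned ?Z)"
          by (rule aligned_add_max) (use max Z lt in force)
        finally have al: "?S (aligned Z) = f x y + ?S (aligned ?Z)"
          by simp
        have IH: "?S ?Z \<le> ?S (aligned ?Z)"
          using less.hyps[of ?Z] less.prems by (simp add: Z)
        have "f s y + f x t \<le> f s t + f x y"
          by (rule supermodular_onD[OF assms(1)]) (use mem lt in auto)
        \<comment> \<open>The exchange alone gives the strict gain, so here the weak half of the
          induction hypothesis suffices.\<close>
        moreover have "f s y + f x t < f s t + f x y" if "strict_supermodular_on X Y f"
          by (rule strict_supermodular_onD[OF that]) (use mem lt in auto)
        ultimately show ?thesis
          using IH unfolding al by (auto simp: Z)
      qed
    qed
  qed
  then show "?S Z \<le> ?S (aligned Z)"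
    and "\<lbrakk>strict_supermodular_on X Y f; Z \<noteq> aligned Z\<rbrakk> \<Longrightarrow> ?S Z < ?S (aligned Z)"
    by auto
qed

text \<open>Negation reverses the order of the second components and so turns opposite pairing into
  monotone pairing.\<close>

lemma antialigned_conv_aligned:
  fixes Z :: "('a::linorder \<times> real) multiset"
  shows "image_mset (apsnd uminus) (antialigned Z) = aligned (image_mset (apsnd uminus) Z)"
proof -
  have "sorted_list_of_multiset (image_mset uminus Y) = map uminus (rev (sorted_list_of_multiset Y))"
    for Y :: "real multiset"
    by (rule sorted_list_of_multiset_unique)
       (auto simp: sorted_wrt_rev sorted_wrt_map sorted_sorted_list_of_multiset)
  from this[of "image_mset snd Z"] show ?thesis
    by (simp add: antialigned_def aligned_def multiset.map_comp o_def zip_map2 case_prod_unfold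
        apsnd_def map_prod_def flip: mset_map)
qed

text \<open>The reflection y to -y interchanges sub- and supermodularity. The function
  \<open>?g\<close> is thus supermodular on X and -Y, and the aligned case applies to the reflected
  pairs.\<close>

lemma
  fixes Z :: "('a::linorder \<times> real) multiset"
  assumes "supermodular_on X Y (\<lambda>x y. - f x y)" "set_mset Z \<subseteq> X \<times> Y"
  shows sum_le_sum_antialigned: "(\<Sum>(x, y)\<in>#Z. f x y) \<le> (\<Sum>(x, y)\<in>#antialigned Z. f x y)"
    and sum_less_sum_antialigned: "\<lbrakk>strict_supermodular_on X Y (\<lambda>x y. - f x y); Z \<noteq> antialigned Z\<rbrakk>
      \<Longrightarrow> (\<Sum>(x, y)\<in>#Z. f x y) < (\<Sum>(x, y)\<in>#antialigned Z. f x y)"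
proof -
  let ?N = "image_mset (apsnd (uminus :: real \<Rightarrow> real)) :: ('a \<times> real) multiset \<Rightarrow> _"
  let ?g = "\<lambda>x y. f x (- y)"
  have sum: "(\<Sum>(x, y)\<in>#W. f x y) = (\<Sum>(x, y)\<in>#?N W. ?g x y)" for W
    by (simp add: multiset.map_comp o_def case_prod_unfold)
  have "?N (?N W) = W" for W
    by (simp add: multiset.map_comp o_def case_prod_unfold apsnd_def map_prod_def)
  then have inj: "?N W = ?N W' \<Longrightarrow> W = W'" for W W'
    by metis
  have subs: "set_mset (?N Z) \<subseteq> X \<times> uminus ` Y"
    using assms(2) by auto
  have super: "supermodular_on X (uminus ` Y) ?g"
    using assms(1) by (fastforce simp: supermodular_on_def)
  show "(\<Sum>(x, y)\<in>#Z. f x y) \<le> (\<Sum>(x, y)\<in>#antialigned Z. f x y)"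
    unfolding sum antialigned_conv_aligned by (rule sum_le_sum_aligned[OF super subs])
  assume "strict_supermodular_on X Y (\<lambda>x y. - f x y)" and ne: "Z \<noteq> antialigned Z"
  then have "strict_supermodular_on X (uminus ` Y) ?g"
    by (fastforce simp: strict_supermodular_on_def)
  moreover have "?N Z \<noteq> aligned (?N Z)"
    using ne inj unfolding antialigned_conv_aligned[symmetric] by blast
  ultimately show "(\<Sum>(x, y)\<in>#Z. f x y) < (\<Sum>(x, y)\<in>#antialigned Z. f x y)"
    unfolding sum antialigned_conv_aligned by (rule sum_less_sum_aligned[OF super subs])
qed

section \<open>Unitary diagonalization\<close>

lemma mat_mult_assoc:
  "\<lbrakk>dim_col A = dim_row B; dim_col B = dim_row C\<rbrakk> \<Longrightarrow> A * B * C = A * (B * C)"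
  by (metis assoc_mult_mat carrier_mat_triv)

lemma mat_adjoint_dim [simp]:
  "dim_row (mat_adjoint A) = dim_col A" "dim_col (mat_adjoint A) = dim_row A"
  by (auto simp: mat_adjoint_def)

lemma mat_adjoint_carrier [simp]: "A \<in> carrier_mat m n \<Longrightarrow> mat_adjoint A \<in> carrier_mat n m"
  by (rule carrier_matI) auto

lemma mat_adjoint_index [simp]:
  fixes A :: "complex mat"
  assumes "i < dim_col A" "j < dim_row A"
  shows "mat_adjoint A $$ (i, j) = cnj (A $$ (j, i))"
  using assms by (simp add: mat_adjoint_def mat_of_rows_def)

lemma mat_adjoint_mat_adjoint [simp]:
  fixes A :: "complex mat"
  shows "mat_adjoint (mat_adjoint A) = A"
  by (rule eq_matI) auto

lemma mat_adjoint_one [simp]: "mat_adjoint (1\<^sub>m n :: complex mat) = 1\<^sub>m n"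
  by (rule eq_matI) auto

lemma mat_adjoint_zero [simp]: "mat_adjoint (0\<^sub>m m n :: complex mat) = 0\<^sub>m n m"
  by (rule eq_matI) auto

lemma mat_adjoint_mult:
  fixes A B :: "complex mat"
  assumes "dim_col A = dim_row B"
  shows "mat_adjoint (A * B) = mat_adjoint B * mat_adjoint A"
  by (rule eq_matI) (use assms in \<open>simp_all add: scalar_prod_def mult.commute\<close>)

lemma mat_adjoint_four_block:
  fixes A B C D :: "complex mat"
  assumes "A \<in> carrier_mat nr1 nc1" "B \<in> carrier_mat nr1 nc2"
    "C \<in> carrier_mat nr2 nc1" "D \<in> carrier_mat nr2 nc2"
  shows "mat_adjoint (four_block_mat A B C D)
    = four_block_mat (mat_adjoint A) (mat_adjoint C) (mat_adjoint B) (mat_adjoint D)"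
  by (rule eq_matI) (use assms in auto)

lemma dim_mat_diag [simp]: "dim_row (mat_diag n d) = n" "dim_col (mat_diag n d) = n"
  by (simp_all add: mat_diag_def)

lemma mat_adjoint_diag: "mat_adjoint (mat_diag n d) = mat_diag n (\<lambda>i. cnj (d i))"
  by (rule eq_matI) (auto simp: mat_diag_def)

lemma diagonal_mat_eq_mat_diag:
  assumes "D \<in> carrier_mat n n" "diagonal_mat D"
  shows "D = mat_diag n (\<lambda>i. D $$ (i, i))"
  by (rule eq_matI) (use assms in \<open>auto simp: mat_diag_def diagonal_mat_def\<close>)

lemma unitary_matD:
  assumes "unitary_mat n U"
  shows "U \<in> carrier_mat n n" "mat_adjoint U * U = 1\<^sub>m n" "U * mat_adjoint U = 1\<^sub>m n"
  using assms mat_mult_left_right_inverse[of "mat_adjoint U" n U] by (auto simp: unitary_mat_def)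

lemma unitary_mat_mult:
  assumes "unitary_mat n U" "unitary_mat n V"
  shows "unitary_mat n (U * V)"
proof -
  note c = unitary_matD[OF assms(1)] unitary_matD[OF assms(2)]
  have "mat_adjoint (U * V) * (U * V) = mat_adjoint V * (mat_adjoint U * U) * V"
    using c(1,4) by (simp add: mat_adjoint_mult mat_mult_assoc)
  also have "\<dots> = 1\<^sub>m n"
    using c by (simp add: right_mult_one_mat[of _ n n])
  finally show ?thesis
    using c by (simp add: unitary_mat_def)
qed

lemma unitary_conjugate_mult:
  assumes U: "unitary_mat n U" and A: "A \<in> carrier_mat n n" and B: "B \<in> carrier_mat n n"
  shows "(mat_adjoint U * A * U) * (mat_adjoint U * B * U) = mat_adjoint U * (A * B) * U"
proof -
  note c = unitary_matD[OF U]
  have "(mat_adjoint U * A * U) * (mat_adjoint U * B * U)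
      = mat_adjoint U * (A * ((U * mat_adjoint U) * (B * U)))"
    using A B c(1) by (simp add: mat_mult_assoc)
  also have "\<dots> = mat_adjoint U * (A * B) * U"
    unfolding c(3) using A B c(1) by (simp add: mat_mult_assoc left_mult_one_mat[of _ n n])
  finally show ?thesis .
qed

lemma unitary_conjugate_adjoint:
  fixes U A :: "complex mat"
  assumes U: "U \<in> carrier_mat n n" and A: "A \<in> carrier_mat n n"
  shows "mat_adjoint (mat_adjoint U * A * U) = mat_adjoint U * mat_adjoint A * U"
  using assms by (simp add: mat_adjoint_mult mat_mult_assoc)

lemma unitary_conjugate_cancel:
  assumes U: "unitary_mat n U" and A: "A \<in> carrier_mat n n"
  shows "U * (mat_adjoint U * A * U) * mat_adjoint U = A"
proof -
  note c = unitary_matD[OF U]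
  have "U * (mat_adjoint U * A * U) * mat_adjoint U = (U * mat_adjoint U) * A * (U * mat_adjoint U)"
    using A c(1) by (simp add: mat_mult_assoc)
  then show ?thesis using A c by simp
qed

text \<open>Gram-Schmidt on a basis starting with \<open>v\<close> keeps \<open>v\<close> as first
  vector and makes the Gram matrix diagonal; rescaling the columns then makes it the identity. The
  scalar \<open>c\<close> comes from this rescaling.\<close>

lemma exists_unitary_mat_first_col:
  fixes v :: "complex vec"
  assumes v: "v \<in> carrier_vec n" "v \<noteq> 0\<^sub>v n"
  shows "\<exists>W c. unitary_mat n W \<and> col W 0 = c \<cdot>\<^sub>v v"
proof -
  interpret cof_vec_space n "TYPE(complex)" .
  define b where "b = basis_completion v"
  define ws where "ws = gram_schmidt n b"
  define W where "W = mat_of_cols n ws"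
  have n: "0 < n" using v by (metis carrier_vecD gr0I vec_of_dim_0)
  note b = basis_completion[OF v, folded b_def]
  then obtain vs where bv: "b = v # vs" using n by (cases b) auto
  note gs = gram_schmidt_result[OF b(2,4,5) ws_def]
  have hd: "hd ws = v"
    using gram_schmidt_hd[OF v(1), of vs] by (simp add: ws_def bv)
  have len: "length ws = n" using gs b by simp
  have W: "W \<in> carrier_mat n n" using len by (simp add: W_def mat_of_cols_def)
  have "corthogonal_mat W"
    unfolding W_def by (rule orthogonal_mat_of_cols) (use gs len in auto)
  then have diag: "diagonal_mat (mat_adjoint W * W)"
    and nz: "\<And>i. i < n \<Longrightarrow> (mat_adjoint W * W) $$ (i, i) \<noteq> 0"
    using W by (auto simp: corthogonal_mat_def Let_def)
  \<comment> \<open>The squared length of column i, which is the i-th diagonal entry of the Gram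
    matrix.\<close>
  define r where "r i = (\<Sum>k<n. (cmod (W $$ (k, i)))\<^sup>2)" for i
  have r: "(mat_adjoint W * W) $$ (i, i) = of_real (r i)" if "i < n" for i
    using that W by (simp add: scalar_prod_def r_def lessThan_atLeast0 complex_norm_square mult.commute
        del: of_real_power)
  have r_pos: "0 < r i" if "i < n" for i
  proof -
    have "r i \<noteq> 0" using nz[OF that] r[OF that] by (metis of_real_0)
    moreover have "0 \<le> r i" by (simp add: r_def sum_nonneg)
    ultimately show ?thesis by simp
  qed
  define d where "d i = complex_of_real (1 / sqrt (r i))" for i
  have cnj_d: "(\<lambda>i. cnj (d i)) = d" unfolding d_def by simp
  let ?U = "W * mat_diag n d"
  have "mat_adjoint ?U * ?U = mat_diag n d * (mat_adjoint W * W) * mat_diag n d"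
    using carrier_matD[OF W] by (simp add: mat_adjoint_mult mat_mult_assoc mat_adjoint_diag cnj_d)
  also have "mat_adjoint W * W = mat_diag n (\<lambda>i. of_real (r i))"
    by (subst diagonal_mat_eq_mat_diag[of _ n, OF _ diag])
       (use W r in \<open>auto simp: mat_diag_def intro!: eq_matI\<close>)
  also have "mat_diag n d * mat_diag n (\<lambda>i. of_real (r i)) * mat_diag n d = 1\<^sub>m n"
  proof -
    have "d i * of_real (r i) * d i = 1" if "i < n" for i
      using r_pos[OF that] unfolding d_def
      by (simp flip: of_real_mult add: field_simps)
    then show ?thesis
      unfolding mat_diag_diag by (auto simp: mat_diag_def intro!: eq_matI)
  qed
  finally have "unitary_mat n ?U"
    using W by (simp add: unitary_mat_def)
  moreover have "col ?U 0 = d 0 \<cdot>\<^sub>v v"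
  proof (rule eq_vecI)
    fix i assume "i < dim_vec (d 0 \<cdot>\<^sub>v v)"
    then have i: "i < n" using v by simp
    have "W $$ (i, 0) = v $ i"
      using i n len hd by (cases ws) (auto simp: W_def mat_of_cols_def)
    then show "col ?U 0 $ i = (d 0 \<cdot>\<^sub>v v) $ i"
      using i n W v by (simp add: mat_diag_mult_right[OF W] mult.commute)
  qed (use W v in auto)
  ultimately show ?thesis by blast
qed


text \<open>The zero pattern of the first column of a normal matrix forces that of the first row:
  compare the top left entries of \<open>N N\<^sup>*\<close> and \<open>N\<^sup>* N\<close>.\<close>

lemma normal_mat_first_row_zero:
  fixes N :: "complex mat"
  assumes N: "N \<in> carrier_mat (Suc m) (Suc m)" "N * mat_adjoint N = mat_adjoint N * N"
    and col: "\<And>i. 0 < i \<Longrightarrow> i \<le> m \<Longrightarrow> N $$ (i, 0) = 0"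
    and j: "0 < j" "j \<le> m"
  shows "N $$ (0, j) = 0"
proof -
  have "(N * mat_adjoint N) $$ (0, 0) = of_real (\<Sum>k\<le>m. (cmod (N $$ (0, k)))\<^sup>2)"
    using N(1) by (simp add: scalar_prod_def complex_norm_square atLeast0LessThan lessThan_Suc_atMost
        del: of_real_power)
  moreover have "(mat_adjoint N * N) $$ (0, 0) = of_real (\<Sum>k\<le>m. (cmod (N $$ (k, 0)))\<^sup>2)"
    using N(1) by (simp add: scalar_prod_def complex_norm_square atLeast0LessThan lessThan_Suc_atMost
        mult.commute del: of_real_power)
  ultimately have "(\<Sum>k\<le>m. (cmod (N $$ (0, k)))\<^sup>2) = (\<Sum>k\<le>m. (cmod (N $$ (k, 0)))\<^sup>2)"
    using N(2) by (metis of_real_eq_iff)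
  also have "\<dots> = (cmod (N $$ (0, 0)))\<^sup>2"
    using col by (subst sum.remove[of _ 0]) auto
  finally have "(\<Sum>k\<in>{..m} - {0}. (cmod (N $$ (0, k)))\<^sup>2) = 0"
    by (subst (asm) sum.remove[of _ 0]) auto
  then show ?thesis
    using j by (subst (asm) sum_nonneg_eq_0_iff) auto
qed

lemma mat_eq_four_block_diag:
  assumes T: "T \<in> carrier_mat (Suc m) (Suc m)"
    and col: "\<And>i. 0 < i \<Longrightarrow> i \<le> m \<Longrightarrow> T $$ (i, 0) = 0"
    and row: "\<And>j. 0 < j \<Longrightarrow> j \<le> m \<Longrightarrow> T $$ (0, j) = 0"
  shows "T = four_block_mat (mat 1 1 (\<lambda>_. T $$ (0, 0))) (0\<^sub>m 1 m) (0\<^sub>m m 1)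
    (mat m m (\<lambda>(i, j). T $$ (Suc i, Suc j)))"
  by (rule eq_matI) (use assms in \<open>auto simp: less_Suc_eq_le\<close>)

lemma mult_four_block_diag:
  assumes "A \<in> carrier_mat 1 1" "B \<in> carrier_mat 1 1" "D \<in> carrier_mat m m" "E \<in> carrier_mat m m"
  shows "four_block_mat A (0\<^sub>m 1 m) (0\<^sub>m m 1) D * four_block_mat B (0\<^sub>m 1 m) (0\<^sub>m m 1) E
    = four_block_mat (A * B) (0\<^sub>m 1 m) (0\<^sub>m m 1) (D * E)"
  by (subst mult_four_block_mat[of _ 1 1 _ m _ m _ _ 1 _ m]) (use assms in auto)

lemma four_block_diag_eqD:
  assumes "four_block_mat A (0\<^sub>m 1 m) (0\<^sub>m m 1) D = four_block_mat B (0\<^sub>m 1 m) (0\<^sub>m m 1) E"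
    and "A \<in> carrier_mat 1 1" "B \<in> carrier_mat 1 1" "D \<in> carrier_mat m m" "E \<in> carrier_mat m m"
  shows "D = E"
proof (rule eq_matI)
  fix i j assume "i < dim_row E" "j < dim_col E"
  then show "D $$ (i, j) = E $$ (i, j)"
    using arg_cong[OF assms(1), of "\<lambda>M. M $$ (Suc i, Suc j)"] assms(2-) by simp
qed (use assms in auto)

text \<open>Deflation: in an orthonormal basis starting with an eigenvector the first column
  vanishes below the diagonal. Normality then clears the first row as well and passes to the
  remaining block.\<close>

theorem normal_mat_unitary_diagonalization:
  fixes N :: "complex mat"
  assumes "N \<in> carrier_mat n n" "N * mat_adjoint N = mat_adjoint N * N"
  shows "\<exists>U. unitary_mat n U \<and> diagonal_mat (mat_adjoint U * N * U)"
  using assms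
proof (induction n arbitrary: N)
  case 0
  then have "unitary_mat 0 (1\<^sub>m 0) \<and> diagonal_mat (mat_adjoint (1\<^sub>m 0) * N * 1\<^sub>m 0)"
    by (auto simp: unitary_mat_def diagonal_mat_def)
  then show ?case by blast
next
  case (Suc m)
  note N = Suc.prems
  obtain e where "eigenvalue N e"
    using spectrum_non_empty[OF N(1)] by (auto simp: spectrum_def)
  then obtain v where v: "v \<in> carrier_vec (Suc m)" "v \<noteq> 0\<^sub>v (Suc m)" "N *\<^sub>v v = e \<cdot>\<^sub>v v"
    using N(1) by (auto simp: eigenvalue_def eigenvector_def)
  obtain W c where W: "unitary_mat (Suc m) W" and W0: "col W 0 = c \<cdot>\<^sub>v v"
    using exists_unitary_mat_first_col[OF v(1,2)] by blast
  note Wc = unitary_matD[OF W]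
  define T where "T = mat_adjoint W * N * W"
  have T: "T \<in> carrier_mat (Suc m) (Suc m)"
    using N(1) Wc(1) unfolding T_def by (intro mult_carrier_mat mat_adjoint_carrier)
  have NW: "N *\<^sub>v col W 0 = e \<cdot>\<^sub>v col W 0"
    using v N(1) by (simp add: W0 mult_mat_vec smult_smult_assoc mult.commute)
  have T_eq: "T = mat_adjoint W * (N * W)"
    using N(1) Wc(1) by (simp add: T_def mat_mult_assoc)
  have "T $$ (i, 0) = (if i = 0 then e else 0)" if "i \<le> m" for i
  proof -
    have "T $$ (i, 0) = row (mat_adjoint W) i \<bullet> (N *\<^sub>v col W 0)"
      using T_eq that N(1) Wc(1) by (simp add: col_mult2[of _ "Suc m" "Suc m" _ "Suc m"] mult_mat_vec_def)
    also have "\<dots> = e * (mat_adjoint W * W) $$ (i, 0)"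
      using that Wc(1) unfolding NW by simp
    finally show ?thesis
      using that by (simp add: Wc(2))
  qed
  then have col: "T $$ (i, 0) = 0" if "0 < i" "i \<le> m" for i
    using that by simp
  have adjT: "mat_adjoint T = mat_adjoint W * mat_adjoint N * W"
    unfolding T_def using N(1) Wc(1) by (intro unitary_conjugate_adjoint)
  have T_normal: "T * mat_adjoint T = mat_adjoint T * T"
    unfolding adjT unfolding T_def
    using N Wc(1) by (simp add: unitary_conjugate_mult[OF W])
  have row: "T $$ (0, j) = 0" if "0 < j" "j \<le> m" for j
    using normal_mat_first_row_zero[OF T T_normal col that] .
  let ?Z = "0\<^sub>m 1 m :: complex mat"
    and ?Z' = "0\<^sub>m m 1 :: complex mat"
  define E where "E = mat 1 1 (\<lambda>_. T $$ (0, 0))"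
  define D where "D = mat m m (\<lambda>(i, j). T $$ (Suc i, Suc j))"
  have E: "E \<in> carrier_mat 1 1" and D: "D \<in> carrier_mat m m"
    by (simp_all add: E_def D_def)
  have T_block: "T = four_block_mat E ?Z ?Z' D"
    unfolding D_def E_def by (rule mat_eq_four_block_diag[OF T col row])
  have adj_block: "mat_adjoint (four_block_mat A ?Z ?Z' B) = four_block_mat (mat_adjoint A) ?Z ?Z' (mat_adjoint B)"
    if "A \<in> carrier_mat 1 1" "B \<in> carrier_mat m m" for A B :: "complex mat"
    using that by (simp add: mat_adjoint_four_block[of _ 1 1 _ m _ m])
  have "D * mat_adjoint D = mat_adjoint D * D"
  proof (rule four_block_diag_eqD)
    show "four_block_mat (E * mat_adjoint E) ?Z ?Z' (D * mat_adjoint D)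
        = four_block_mat (mat_adjoint E * E) ?Z ?Z' (mat_adjoint D * D)"
      using T_normal unfolding T_block adj_block[OF E D]
      by (simp only: mult_four_block_diag E D mat_adjoint_carrier)
  qed (use E D in \<open>auto intro!: mult_carrier_mat mat_adjoint_carrier\<close>)
  then obtain V where V: "unitary_mat m V" and diag: "diagonal_mat (mat_adjoint V * D * V)"
    using Suc.IH[OF D] by blast
  note Vc = unitary_matD[OF V]
  define V' where "V' = four_block_mat (1\<^sub>m 1) ?Z ?Z' V"
  have V'c: "V' \<in> carrier_mat (Suc m) (Suc m)"
    using Vc(1) by (intro carrier_matI) (auto simp: V'_def)
  have V': "unitary_mat (Suc m) V'"
    unfolding unitary_mat_def using V'c Vc
    by (simp add: V'_def adj_block mult_four_block_diag plus_1_eq_Suc del: One_nat_def)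
  have "mat_adjoint (W * V') * N * (W * V') = mat_adjoint V' * T * V'"
    using N(1) Wc(1) V'c by (simp add: T_def mat_adjoint_mult mat_mult_assoc)
  also have "\<dots> = four_block_mat E ?Z ?Z' (mat_adjoint V * D * V)"
    using Vc E D mult_carrier_mat[OF mat_adjoint_carrier[OF Vc(1)] D] unfolding T_block V'_def
    by (simp add: adj_block mult_four_block_diag del: One_nat_def)
  also have "diagonal_mat \<dots>"
    using diag Vc D E by (auto simp: diagonal_mat_def)
  finally show ?case
    using unitary_mat_mult[OF W V'] by blast
qed

text \<open>Two commuting self-adjoint matrices are the real and imaginary parts of a normal matrix.\<close>

theorem commuting_self_adjoint_diagonalization:
  assumes A: "A \<in> carrier_mat n n" "self_adjoint_mat A" and B: "B \<in> carrier_mat n n" "self_adjoint_mat B"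
    and comm: "A * B = B * A"
  shows "\<exists>U. unitary_mat n U \<and> diagonal_mat (mat_adjoint U * A * U) \<and> diagonal_mat (mat_adjoint U * B * U)"
proof -
  define N where "N = A + \<i> \<cdot>\<^sub>m B"
  have N: "N \<in> carrier_mat n n" using A B by (simp add: N_def)
  have sa: "cnj (X $$ (i, j)) = X $$ (j, i)" if "self_adjoint_mat X" "X \<in> carrier_mat n n" "i < n" "j < n" for X i j
    using that mat_adjoint_index[of j X i] by (simp add: self_adjoint_mat_def)
  have adjN: "mat_adjoint N = A + (- \<i>) \<cdot>\<^sub>m B"
    by (rule eq_matI) (use A B sa in \<open>auto simp: N_def\<close>)
  have "N * mat_adjoint N = mat_adjoint N * N"
    unfolding adjN unfolding N_def using A B comm
    by (simp add: add_mult_distrib_mat[of _ n n _ _ n] mult_add_distrib_mat[of _ n n _ n]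
        mult_smult_distrib[of _ n n _ n] mult_smult_assoc_mat[of _ n n _ n])
       (auto simp: algebra_simps intro: eq_matI)
  then obtain U where U: "unitary_mat n U" and diag: "diagonal_mat (mat_adjoint U * N * U)"
    using normal_mat_unitary_diagonalization[OF N] by blast
  note Uc = unitary_matD(1)[OF U]
  let ?A = "mat_adjoint U * A * U" and ?B = "mat_adjoint U * B * U"
  have c: "?A \<in> carrier_mat n n" "?B \<in> carrier_mat n n"
    using A B Uc by (auto intro!: mult_carrier_mat mat_adjoint_carrier)
  have s: "self_adjoint_mat ?A" "self_adjoint_mat ?B"
    using A B Uc by (simp_all add: self_adjoint_mat_def unitary_conjugate_adjoint)
  have "mat_adjoint U * N * U = ?A + \<i> \<cdot>\<^sub>m ?B"
    unfolding N_def using A B Uc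
    by (simp add: add_mult_distrib_mat[of _ n n _ _ n] mult_add_distrib_mat[of _ n n _ n]
        mult_smult_distrib[of _ n n _ n] mult_smult_assoc_mat[of _ n n _ n] mult_carrier_mat[of _ n n _ n])
  then have off: "?A $$ (i, j) + \<i> * ?B $$ (i, j) = 0" if "i < n" "j < n" "i \<noteq> j" for i j
    using diag that c Uc by (simp add: diagonal_mat_def del: index_mult_mat(1))
  have "?A $$ (i, j) = 0 \<and> ?B $$ (i, j) = 0" if "i < n" "j < n" "i \<noteq> j" for i j
  proof -
    \<comment> \<open>Self-adjointness turns the conjugate of the equation at (j, i) into the one at
      (i, j) with -\<i> in place of \<i>; together the two equations make both entries
      vanish.\<close>
    have "cnj (?A $$ (j, i) + \<i> * ?B $$ (j, i)) = 0"
      using off[of j i] that by (simp del: index_mult_mat(1))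
    then have "?A $$ (i, j) - \<i> * ?B $$ (i, j) = 0"
      using sa[OF s(1) c(1)] sa[OF s(2) c(2)] that by (simp del: index_mult_mat(1))
    moreover have "?A $$ (i, j) = - (\<i> * ?B $$ (i, j))"
      using off[OF that] by (simp add: eq_neg_iff_add_eq_0 del: index_mult_mat(1))
    ultimately show ?thesis by (simp del: index_mult_mat(1))
  qed
  then have "diagonal_mat ?A" "diagonal_mat ?B"
    using c by (auto simp: diagonal_mat_def simp del: index_mult_mat(1))
  then show ?thesis using U by blast
qed

section \<open>Schatten norms and singular values\<close>

text \<open>Well-definedness of the functional calculus: two diagonalizations of the same matrix are
  related by the intertwiner \<open>W\<close>, and this relation survives taking powers of the
  diagonals.\<close>

lemma psd_powr_unitary_diag:
  assumes U: "unitary_mat n U" and d: "\<And>i. i < n \<Longrightarrow> 0 \<le> d i"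
  shows "psd_powr (U * mat_diag n (\<lambda>i. of_real (d i)) * mat_adjoint U) r
    = U * mat_diag n (\<lambda>i. of_real (d i powr r)) * mat_adjoint U"
proof -
  let ?M = "\<lambda>d. mat_diag n (\<lambda>i. complex_of_real (d i))"
  let ?P = "U * ?M d * mat_adjoint U"
  note Uc = unitary_matD[OF U]
  have dim: "dim_row ?P = n" using Uc(1) by simp
  show ?thesis
    unfolding psd_powr_def dim
  proof (rule the_equality)
    show "\<exists>V e. unitary_mat n V \<and> (\<forall>i<n. 0 \<le> e i) \<and> ?P = V * ?M e * mat_adjoint V \<and>
      U * ?M (\<lambda>i. d i powr r) * mat_adjoint U = V * ?M (\<lambda>i. e i powr r) * mat_adjoint V"
      using U d by blast
  next
    fix Q
    assume "\<exists>V e. unitary_mat n V \<and> (\<forall>i<n. 0 \<le> e i) \<and> ?P = V * ?M e * mat_adjoint V \<and>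
      Q = V * ?M (\<lambda>i. e i powr r) * mat_adjoint V"
    then obtain V e where V: "unitary_mat n V" and P: "?P = V * ?M e * mat_adjoint V"
      and Q: "Q = V * ?M (\<lambda>i. e i powr r) * mat_adjoint V"
      by blast
    note Vc = unitary_matD[OF V]
    define W where "W = mat_adjoint U * V"
    have W: "W \<in> carrier_mat n n"
      unfolding W_def using Uc(1) Vc(1) by (intro mult_carrier_mat mat_adjoint_carrier)
    have "?M d * W = (mat_adjoint U * U) * ?M d * W"
      using Uc W by (simp add: left_mult_one_mat[of _ n n])
    also have "\<dots> = mat_adjoint U * ?P * V"
      using Uc(1) Vc(1) by (simp add: W_def mat_mult_assoc)
    also have "\<dots> = W * ?M e * (mat_adjoint V * V)"
      unfolding P using Uc(1) Vc(1) by (simp add: W_def mat_mult_assoc)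
    also have "\<dots> = W * ?M e"
      using Vc W by (simp add: right_mult_one_mat[of _ n n])
    finally have "?M d * W = W * ?M e" .
    then have eq: "mat n n (\<lambda>(i, j). of_real (d i) * W $$ (i, j)) = mat n n (\<lambda>(i, j). W $$ (i, j) * of_real (e j))"
      unfolding mat_diag_mult_left[OF W] mat_diag_mult_right[OF W] .
    have "of_real (d i) * W $$ (i, j) = W $$ (i, j) * of_real (e j)" if "i < n" "j < n" for i j
      using that arg_cong[OF eq, of "\<lambda>M. M $$ (i, j)"] by simp
    \<comment> \<open>\<open>W\<close> links only equal eigenvalues, so it also intertwines the
      diagonals obtained by applying one function to both.\<close>
    then have "W $$ (i, j) = 0 \<or> d i = e j" if "i < n" "j < n" for i j
      using that by (metis mult.commute mult_cancel_right of_real_eq_iff)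
    then have "?M (\<lambda>i. d i powr r) * W = W * ?M (\<lambda>i. e i powr r)"
      unfolding mat_diag_mult_left[OF W] mat_diag_mult_right[OF W] by (intro eq_matI) fastforce+
    then have "U * (?M (\<lambda>i. d i powr r) * W) * mat_adjoint V = U * (W * ?M (\<lambda>i. e i powr r)) * mat_adjoint V"
      by simp
    also have "U * (?M (\<lambda>i. d i powr r) * W) * mat_adjoint V
        = U * (?M (\<lambda>i. d i powr r) * (mat_adjoint U * (V * mat_adjoint V)))"
      using Uc(1) Vc(1) by (simp add: W_def mat_mult_assoc)
    also have "\<dots> = U * ?M (\<lambda>i. d i powr r) * mat_adjoint U"
      using Uc(1) Vc by (simp add: mat_mult_assoc right_mult_one_mat[of _ n n])
    also have "U * (W * ?M (\<lambda>i. e i powr r)) * mat_adjoint V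
        = (U * mat_adjoint U) * (V * (?M (\<lambda>i. e i powr r) * mat_adjoint V))"
      using Uc(1) Vc(1) by (simp add: W_def mat_mult_assoc)
    also have "\<dots> = Q"
      unfolding Q Uc(3) using Vc(1) by (simp add: mat_mult_assoc left_mult_one_mat'[of _ n])
    finally show "Q = U * ?M (\<lambda>i. d i powr r) * mat_adjoint U" by simp
  qed
qed

lemma trace_unitary_diag:
  assumes "unitary_mat n U"
  shows "trace_mat (U * mat_diag n d * mat_adjoint U) = (\<Sum>i<n. d i)"
proof -
  note U = unitary_matD[OF assms]
  have col: "(\<Sum>i<n. cnj (U $$ (i, k)) * U $$ (i, k)) = 1" if "k < n" for k
  proof -
    have "(mat_adjoint U * U) $$ (k, k) = (\<Sum>i<n. cnj (U $$ (i, k)) * U $$ (i, k))"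
      using U(1) that by (simp add: scalar_prod_def atLeast0LessThan)
    then show ?thesis using U(2) that by simp
  qed
  have "trace_mat (U * mat_diag n d * mat_adjoint U)
      = (\<Sum>i<n. \<Sum>k<n. U $$ (i, k) * d k * cnj (U $$ (i, k)))"
    unfolding mat_diag_mult_right[OF U(1)] trace_mat_def
    using U(1) by (simp add: scalar_prod_def atLeast0LessThan)
  also have "\<dots> = (\<Sum>k<n. d k * (\<Sum>i<n. cnj (U $$ (i, k)) * U $$ (i, k)))"
    by (subst sum.swap) (simp add: sum_distrib_left mult_ac)
  also have "\<dots> = (\<Sum>k<n. d k)"
    by (rule sum.cong) (simp_all add: col)
  finally show ?thesis .
qed

lemma adjoint_mult_self_diagonalization:
  fixes X :: "complex mat"
  assumes U: "unitary_mat n U" and X: "X \<in> carrier_mat n n"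
    and diag: "diagonal_mat (mat_adjoint U * X * U)"
  shows "mat_adjoint X * X
    = U * mat_diag n (\<lambda>i. of_real ((cmod ((mat_adjoint U * X * U) $$ (i, i)))\<^sup>2)) * mat_adjoint U"
proof -
  note Uc = unitary_matD(1)[OF U]
  define T where "T = mat_adjoint U * X * U"
  have T: "T \<in> carrier_mat n n"
    unfolding T_def using Uc X by (intro mult_carrier_mat mat_adjoint_carrier)
  have TD: "T = mat_diag n (\<lambda>i. T $$ (i, i))"
    using diagonal_mat_eq_mat_diag[OF T] diag by (simp add: T_def)
  have "mat_adjoint U * (mat_adjoint X * X) * U = mat_adjoint T * T"
    unfolding T_def unitary_conjugate_adjoint[OF Uc X]
    using unitary_conjugate_mult[OF U mat_adjoint_carrier[OF X] X] by simp
  also have "\<dots> = mat_diag n (\<lambda>i. cnj (T $$ (i, i)) * T $$ (i, i))"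
    by (subst (1 2) TD) (simp add: mat_adjoint_diag)
  also have "\<dots> = mat_diag n (\<lambda>i. of_real ((cmod (T $$ (i, i)))\<^sup>2))"
    by (simp add: complex_norm_square mult.commute del: of_real_power)
  finally have "U * (mat_adjoint U * (mat_adjoint X * X) * U) * mat_adjoint U
      = U * mat_diag n (\<lambda>i. of_real ((cmod (T $$ (i, i)))\<^sup>2)) * mat_adjoint U"
    by simp
  then show ?thesis
    using unitary_conjugate_cancel[OF U mult_carrier_mat[OF mat_adjoint_carrier[OF X] X]]
    by (simp add: T_def)
qed

lemma schatten_norm_powr:
  assumes U: "unitary_mat n U" and X: "X \<in> carrier_mat n n"
    and diag: "diagonal_mat (mat_adjoint U * X * U)" and p: "1 \<le> p"
  shows "schatten_norm p X powr p = (\<Sum>i<n. cmod ((mat_adjoint U * X * U) $$ (i, i)) powr p)"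
proof -
  let ?t = "\<lambda>i. cmod ((mat_adjoint U * X * U) $$ (i, i))"
  have "psd_powr (mat_adjoint X * X) (p / 2)
      = U * mat_diag n (\<lambda>i. of_real ((?t i)\<^sup>2 powr (p / 2))) * mat_adjoint U"
    unfolding adjoint_mult_self_diagonalization[OF U X diag]
    by (rule psd_powr_unitary_diag[OF U]) simp
  \<comment> \<open>A zero entry is separated off; both sides are then 0 by the convention
    \<open>0 powr r = 0\<close>.\<close>
  moreover have "(?t i)\<^sup>2 powr (p / 2) = ?t i powr p" for i
    by (cases "?t i = 0") (auto simp: powr_powr simp flip: powr_numeral)
  ultimately have "Re (trace_mat (psd_powr (mat_adjoint X * X) (p / 2))) = (\<Sum>i<n. ?t i powr p)"
    by (simp add: trace_unitary_diag[OF U])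
  then show ?thesis
    using p by (simp add: schatten_norm_def powr_powr sum_nonneg)
qed

lemma lp_norm_powr:
  "1 \<le> p \<Longrightarrow> lp_norm p v powr p = (\<Sum>i<dim_vec v. \<bar>v $ i\<bar> powr p)"
  by (simp add: lp_norm_def powr_powr sum_nonneg)

lemma proots_linear_factors:
  "proots (\<Prod>a\<leftarrow>xs. [:- a, 1:]) = mset (xs :: 'a::idom list)"
proof (induction xs)
  case (Cons a xs)
  have "(\<Prod>a\<leftarrow>xs. [:- a, 1:]) \<noteq> 0"
    by (auto simp: prod_list_zero_iff)
  then show ?case
    using Cons by (simp add: proots_mult del: mult_pCons_left)
qed simp

text \<open>Unitary similarity preserves the characteristic polynomial, and that of a diagonal
  matrix splits into linear factors, so \<open>proots\<close> returns the diagonal with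
  multiplicities.\<close>

lemma singular_values_diagonalization:
  assumes U: "unitary_mat n U" and X: "X \<in> carrier_mat n n"
    and diag: "diagonal_mat (mat_adjoint U * X * U)"
  shows "singular_values X = mset (map (\<lambda>i. cmod ((mat_adjoint U * X * U) $$ (i, i))) [0..<n])"
proof -
  let ?t = "\<lambda>i. cmod ((mat_adjoint U * X * U) $$ (i, i))"
  let ?D = "mat_diag n (\<lambda>i. complex_of_real ((?t i)\<^sup>2))"
  note Uc = unitary_matD[OF U]
  have "similar_mat_wit (mat_adjoint X * X) ?D U (mat_adjoint U)"
    by (rule similar_mat_witI[of _ _ n])
       (use Uc X adjoint_mult_self_diagonalization[OF U X diag] in
         \<open>auto intro!: mult_carrier_mat mat_adjoint_carrier\<close>)
  then have "char_poly (mat_adjoint X * X) = char_poly ?D"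
    by (intro char_poly_similar) (auto simp: similar_mat_def)
  also have "\<dots> = (\<Prod>a\<leftarrow>diag_mat ?D. [:- a, 1:])"
    by (rule char_poly_upper_triangular[of _ n]) (auto simp: mat_diag_def)
  also have "diag_mat ?D = map (\<lambda>i. complex_of_real ((?t i)\<^sup>2)) [0..<n]"
    by (simp add: diag_mat_def mat_diag_def)
  finally have "proots (char_poly (mat_adjoint X * X)) = mset (map (\<lambda>i. complex_of_real ((?t i)\<^sup>2)) [0..<n])"
    by (simp only: proots_linear_factors)
  then show ?thesis
    by (simp add: singular_values_def multiset.map_comp o_def del: of_real_power)
qed

section \<open>Alignment\<close>

text \<open>A list, because alignment prescribes an order; the sums and the rearrangement see only
  its multiset.\<close>

definition diagonal_pairs :: "nat \<Rightarrow> complex mat \<Rightarrow> complex mat \<Rightarrow> complex mat \<Rightarrow> (real \<times> real) list" where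
  "diagonal_pairs n U A B = map (\<lambda>i. (cmod ((mat_adjoint U * A * U) $$ (i, i)),
     cmod ((mat_adjoint U * B * U) $$ (i, i)))) [0..<n]"

text \<open>If a and b have opposite signs, the two summands trade places. Hence singular values can
  stand in for eigenvalues.\<close>

lemma abs_add_sub_powr:
  fixes a b :: real
  shows "\<bar>a + b\<bar> powr p + \<bar>a - b\<bar> powr p = sum_diff_powr p \<bar>a\<bar> \<bar>b\<bar>"
proof -
  have "\<bar>a + b\<bar> = \<bar>\<bar>a\<bar> + \<bar>b\<bar>\<bar> \<and> \<bar>a - b\<bar> = \<bar>\<bar>a\<bar> - \<bar>b\<bar>\<bar> \<or>
    \<bar>a + b\<bar> = \<bar>\<bar>a\<bar> - \<bar>b\<bar>\<bar> \<and> \<bar>a - b\<bar> = \<bar>\<bar>a\<bar> + \<bar>b\<bar>\<bar>"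
    by arith
  then show ?thesis by (auto simp: sum_diff_powr_def)
qed

lemma schatten_norm_sum_diff:
  assumes U: "unitary_mat n U" and A: "A \<in> carrier_mat n n" "self_adjoint_mat A"
    and B: "B \<in> carrier_mat n n" "self_adjoint_mat B"
    and diag: "diagonal_mat (mat_adjoint U * A * U)" "diagonal_mat (mat_adjoint U * B * U)"
    and p: "1 \<le> p"
  shows "schatten_norm p (A + B) powr p + schatten_norm p (A - B) powr p
    = (\<Sum>(x, y)\<in>#mset (diagonal_pairs n U A B). sum_diff_powr p x y)"
proof -
  let ?A = "mat_adjoint U * A * U" and ?B = "mat_adjoint U * B * U"
  note Uc = unitary_matD(1)[OF U]
  have c: "?A \<in> carrier_mat n n" "?B \<in> carrier_mat n n"
    using A B Uc by (auto intro!: mult_carrier_mat mat_adjoint_carrier)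
  have add: "mat_adjoint U * (A + B) * U = ?A + ?B"
    using A B Uc by (simp add: add_mult_distrib_mat[of _ n n _ _ n] mult_add_distrib_mat[of _ n n _ n]
        mult_carrier_mat[of _ n n _ n])
  have sub: "mat_adjoint U * (A - B) * U = ?A - ?B"
    using A B Uc by (simp add: minus_mult_distrib_mat[of _ n n _ _ n] mult_minus_distrib_mat[of _ n n _ n]
        mult_carrier_mat[of _ n n _ n])
  have diag_add: "diagonal_mat (mat_adjoint U * (A + B) * U)"
    unfolding add using diag c Uc by (auto simp: diagonal_mat_def simp del: index_mult_mat(1))
  have diag_sub: "diagonal_mat (mat_adjoint U * (A - B) * U)"
    unfolding sub using diag c Uc by (auto simp: diagonal_mat_def simp del: index_mult_mat(1))
  \<comment> \<open>The eigenvalues must be real for \<open>abs_add_sub_powr\<close> to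
    apply.\<close>
  have real: "X $$ (i, i) \<in> \<real>" if "mat_adjoint X = X" "X \<in> carrier_mat n n" "i < n" for X :: "complex mat" and i
    using that mat_adjoint_index[of i X i] by (simp add: complex_is_Real_iff complex_eq_iff)
  have "mat_adjoint ?A = ?A" "mat_adjoint ?B = ?B"
    using A B Uc by (simp_all add: self_adjoint_mat_def unitary_conjugate_adjoint)
  then have "cmod (?A $$ (i, i) + ?B $$ (i, i)) powr p + cmod (?A $$ (i, i) - ?B $$ (i, i)) powr p
      = sum_diff_powr p (cmod (?A $$ (i, i))) (cmod (?B $$ (i, i)))" if i: "i < n" for i
  proof -
    obtain a b where "?A $$ (i, i) = of_real a" "?B $$ (i, i) = of_real b"
      using real[of ?A i] real[of ?B i] c i \<open>mat_adjoint ?A = ?A\<close> \<open>mat_adjoint ?B = ?B\<close>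
      by (auto elim!: Reals_cases simp del: index_mult_mat(1))
    then show ?thesis
      by (simp add: abs_add_sub_powr flip: of_real_add of_real_diff del: index_mult_mat(1))
  qed
  moreover have "schatten_norm p (A + B) powr p = (\<Sum>i<n. cmod (?A $$ (i, i) + ?B $$ (i, i)) powr p)"
    using A B c Uc unfolding schatten_norm_powr[OF U add_carrier_mat[OF B(1)] diag_add p] add
    by (intro sum.cong) (auto simp del: index_mult_mat(1))
  moreover have "schatten_norm p (A - B) powr p = (\<Sum>i<n. cmod (?A $$ (i, i) - ?B $$ (i, i)) powr p)"
    using A B c Uc unfolding schatten_norm_powr[OF U minus_carrier_mat[OF B(1)] diag_sub p] sub
    by (intro sum.cong) (auto simp del: index_mult_mat(1))
  ultimately have "schatten_norm p (A + B) powr p + schatten_norm p (A - B) powr p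
      = (\<Sum>i<n. sum_diff_powr p (cmod (?A $$ (i, i))) (cmod (?B $$ (i, i))))"
    by (simp flip: sum.distrib del: index_mult_mat(1))
  then show ?thesis
    by (simp add: diagonal_pairs_def sum_unfold_sum_mset atLeast0LessThan multiset.map_comp o_def
        del: index_mult_mat(1))
qed

lemma lp_norm_sum_diff:
  assumes "length xs = length ys" and "1 \<le> p"
  shows "lp_norm p (vec_of_list xs + vec_of_list ys) powr p + lp_norm p (vec_of_list xs - vec_of_list ys) powr p
    = (\<Sum>(x, y)\<in>#mset (zip xs ys). sum_diff_powr p x y)"
proof -
  have "lp_norm p (vec_of_list xs + vec_of_list ys) powr p + lp_norm p (vec_of_list xs - vec_of_list ys) powr p
      = (\<Sum>i<length ys. sum_diff_powr p (xs ! i) (ys ! i))"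
    unfolding lp_norm_powr[OF \<open>1 \<le> p\<close>] using assms(1)
    by (simp add: sum_diff_powr_def vec_of_list_index sum.distrib)
  also have "\<dots> = (\<Sum>(x, y)\<leftarrow>zip xs ys. sum_diff_powr p x y)"
    using assms(1) by (simp add: sum_list_sum_nth atLeast0LessThan)
  finally show ?thesis
    by (simp add: sum_mset_sum_list flip: mset_map)
qed

lemma unitary_permute_columns:
  assumes U: "unitary_mat n U" and f: "f permutes {..<n}"
  defines "V \<equiv> mat n n (\<lambda>(i, j). U $$ (i, f j))"
  shows "unitary_mat n V"
    and "\<And>X i j. \<lbrakk>X \<in> carrier_mat n n; i < n; j < n\<rbrakk> \<Longrightarrow>
      (mat_adjoint V * X * V) $$ (i, j) = (mat_adjoint U * X * U) $$ (f i, f j)"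
proof -
  note Uc = unitary_matD[OF U]
  have f_less: "f i < n" if "i < n" for i
    using permutes_in_image[OF f, of i] that by simp
  have V: "V \<in> carrier_mat n n" by (simp add: V_def)
  have colV: "col V j = col U (f j)" if "j < n" for j
    using Uc(1) that f_less[OF that] by (auto simp: V_def)
  have rowV: "row (mat_adjoint V) i = row (mat_adjoint U) (f i)" if "i < n" for i
    using Uc(1) that f_less[OF that] by (auto simp: V_def)
  have "mat_adjoint V * V = 1\<^sub>m n"
  proof (rule eq_matI)
    fix i j assume "i < dim_row (1\<^sub>m n :: complex mat)" "j < dim_col (1\<^sub>m n :: complex mat)"
    then have ij: "i < n" "j < n" by auto
    have "(mat_adjoint V * V) $$ (i, j) = (mat_adjoint U * U) $$ (f i, f j)"
      using ij V Uc(1) f_less by (simp add: colV rowV)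
    also have "\<dots> = 1\<^sub>m n $$ (i, j)"
      using ij f_less permutes_inj[OF f] by (simp add: Uc(2) inj_eq)
    finally show "(mat_adjoint V * V) $$ (i, j) = 1\<^sub>m n $$ (i, j)" .
  qed (use V in auto)
  then show "unitary_mat n V"
    using V by (simp add: unitary_mat_def)
  show "(mat_adjoint V * X * V) $$ (i, j) = (mat_adjoint U * X * U) $$ (f i, f j)"
    if X: "X \<in> carrier_mat n n" and ij: "i < n" "j < n" for X i j
  proof -
    have "(mat_adjoint V * X * V) $$ (i, j) = row (mat_adjoint V) i \<bullet> (X *\<^sub>v col V j)"
      using V X ij by (simp add: mat_mult_assoc col_mult2[of _ n n _ n] mult_mat_vec_def)
    also have "\<dots> = row (mat_adjoint U) (f i) \<bullet> (X *\<^sub>v col U (f j))"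
      using ij by (simp add: rowV colV)
    also have "\<dots> = (mat_adjoint U * X * U) $$ (f i, f j)"
      using Uc(1) X ij f_less by (simp add: mat_mult_assoc col_mult2[of _ n n _ n] mult_mat_vec_def)
    finally show ?thesis .
  qed
qed

lemma simultaneously_aligned_iff:
  assumes len: "length xs = n" "length ys = n"
  shows "simultaneously_aligned n A B (vec_of_list xs) (vec_of_list ys) \<longleftrightarrow>
    (\<exists>U. unitary_mat n U \<and> diagonal_mat (mat_adjoint U * A * U) \<and>
      diagonal_mat (mat_adjoint U * B * U) \<and> diagonal_pairs n U A B = zip xs ys)"
proof -
  have "vec n g = vec_of_list xs \<and> vec n h = vec_of_list ys \<longleftrightarrow> map (\<lambda>i. (g i, h i)) [0..<n] = zip xs ys" for g h
    using len by (auto simp: vec_eq_iff list_eq_iff_nth_eq vec_of_list_index)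
  then show ?thesis
    by (simp add: simultaneously_aligned_def diagonal_pairs_def)
qed

lemma simultaneously_alignedI:
  assumes U: "unitary_mat n U" and A: "A \<in> carrier_mat n n" and B: "B \<in> carrier_mat n n"
    and diag: "diagonal_mat (mat_adjoint U * A * U)" "diagonal_mat (mat_adjoint U * B * U)"
    and len: "length xs = n" "length ys = n"
    and eq: "mset (diagonal_pairs n U A B) = mset (zip xs ys)"
  shows "simultaneously_aligned n A B (vec_of_list xs) (vec_of_list ys)"
proof -
  \<comment> \<open>Since pairs are compared, a single permutation puts both diagonals in order at
    once.\<close>
  obtain f where f: "f permutes {..<n}" and perm: "permute_list f (diagonal_pairs n U A B) = zip xs ys"
    using mset_eq_permutation[OF eq[symmetric]] by (auto simp: diagonal_pairs_def)
  define V where "V = mat n n (\<lambda>(i, j). U $$ (i, f j))"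
  note V = unitary_permute_columns[OF U f, folded V_def]
  have f_less: "f i < n" if "i < n" for i
    using permutes_in_image[OF f, of i] that by simp
  have "diagonal_mat (mat_adjoint V * X * V)" if X: "X \<in> carrier_mat n n" "diagonal_mat (mat_adjoint U * X * U)" for X
    unfolding diagonal_mat_def
  proof (intro allI impI)
    fix i j assume "i < dim_row (mat_adjoint V * X * V)" "j < dim_col (mat_adjoint V * X * V)" "i \<noteq> j"
    then have ij: "i < n" "j < n" "f i \<noteq> f j"
      using permutes_inj[OF f] by (auto simp: V_def inj_eq)
    then show "(mat_adjoint V * X * V) $$ (i, j) = 0"
      using X f_less unitary_matD(1)[OF U] unfolding V(2)[OF X(1) ij(1,2)]
      by (simp add: diagonal_mat_def del: index_mult_mat(1))
  qed
  moreover have "diagonal_pairs n V A B = permute_list f (diagonal_pairs n U A B)"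
    using A B f_less by (auto simp: diagonal_pairs_def permute_list_def V(2) simp del: index_mult_mat(1))
  ultimately show ?thesis
    unfolding simultaneously_aligned_iff[OF len] perm[symmetric] using V(1) A B diag by blast
qed

section \<open>The two bounds and their equality cases\<close>

lemma supermodular_sum_diff_powr:
  assumes "1 \<le> p"
  shows "p \<le> 2 \<Longrightarrow> supermodular_on {0..} {0..} (\<lambda>x y. - sum_diff_powr p x y)"
    and "2 \<le> p \<Longrightarrow> supermodular_on {0..} {0..} (sum_diff_powr p)"
  unfolding supermodular_on_def using sum_diff_powr_exchange_weak[OF assms] by fastforce+

lemma strict_supermodular_sum_diff_powr:
  assumes "1 < p"
  shows "p < 2 \<Longrightarrow> strict_supermodular_on {0..} {0..} (\<lambda>x y. - sum_diff_powr p x y)"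
    and "2 < p \<Longrightarrow> strict_supermodular_on {0..} {0..} (sum_diff_powr p)"
  unfolding strict_supermodular_on_def using sum_diff_powr_exchange[OF assms] by fastforce+

theorem theorem3p1:
  fixes A B :: "complex mat" and n :: nat and p :: real
  assumes A: "A \<in> carrier_mat n n" and B: "B \<in> carrier_mat n n"
    and "self_adjoint_mat A" and "self_adjoint_mat B"
    and "A * B = B * A"
    and "1 \<le> p"
  defines "L \<equiv> lp_norm p (\<sigma>\<^sub>\<down> A + \<sigma>\<^sub>\<down> B) powr p + lp_norm p (\<sigma>\<^sub>\<down> A - \<sigma>\<^sub>\<down> B) powr p"
    and "M \<equiv> schatten_norm p (A + B) powr p + schatten_norm p (A - B) powr p"
    and "R \<equiv> lp_norm p (\<sigma>\<^sub>\<up> A + \<sigma>\<^sub>\<down> B) powr p + lp_norm p (\<sigma>\<^sub>\<up> A - \<sigma>\<^sub>\<down> B) powr p"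
  shows "(p \<le> 2 \<longrightarrow> L \<le> M \<and> M \<le> R) \<and>
    (2 \<le> p \<longrightarrow> R \<le> M \<and> M \<le> L) \<and>
    (p \<noteq> 1 \<and> p \<noteq> 2 \<longrightarrow>
      (L = M \<longleftrightarrow> simultaneously_aligned n A B (\<sigma>\<^sub>\<down> A) (\<sigma>\<^sub>\<down> B)) \<and>
      (M = R \<longleftrightarrow> simultaneously_aligned n A B (\<sigma>\<^sub>\<up> A) (\<sigma>\<^sub>\<down> B)))"
proof -
  obtain U where U: "unitary_mat n U"
    and diag: "diagonal_mat (mat_adjoint U * A * U)" "diagonal_mat (mat_adjoint U * B * U)"
    using commuting_self_adjoint_diagonalization assms by blast
  define Z where "Z = mset (diagonal_pairs n U A B)"
  define a where "a = sorted_list_of_multiset (singular_values A)"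
  define b where "b = sorted_list_of_multiset (singular_values B)"
  let ?S = "\<lambda>Z. \<Sum>(x, y)\<in>#Z. sum_diff_powr p x y"
  have sv: "singular_values A = image_mset fst Z" "singular_values B = image_mset snd Z"
    using singular_values_diagonalization[OF U A diag(1)] singular_values_diagonalization[OF U B diag(2)]
    by (simp_all add: Z_def diagonal_pairs_def multiset.map_comp o_def del: index_mult_mat(1))
  have len: "length a = n" "length b = n"
    by (simp_all add: a_def b_def sv Z_def diagonal_pairs_def)
  have Z_nonneg: "set_mset Z \<subseteq> {0..} \<times> {0..}"
    by (auto simp: Z_def diagonal_pairs_def)
  have \<sigma>: "\<sigma>\<^sub>\<down> A = vec_of_list (rev a)" "\<sigma>\<^sub>\<down> B = vec_of_list (rev b)" "\<sigma>\<^sub>\<up> A = vec_of_list a"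
    by (simp_all add: sigma_down_def sigma_up_def a_def b_def)
  \<comment> \<open>Reversing two lists of equal length only reverses their zip, so decreasing
    against decreasing gives the same multiset as increasing against increasing.\<close>
  have al: "aligned Z = mset (zip (rev a) (rev b))" and anti: "antialigned Z = mset (zip a (rev b))"
    using len by (simp_all add: aligned_def antialigned_def zip_rev a_def b_def sv)
  \<comment> \<open>Stated for every common eigenbasis, since the converse of the equality case
    evaluates \<open>M\<close> in the basis that witnesses alignment.\<close>
  have M: "M = ?S (mset (diagonal_pairs n V A B))"
    if "unitary_mat n V" "diagonal_mat (mat_adjoint V * A * V)" "diagonal_mat (mat_adjoint V * B * V)" for V
    unfolding M_def using that assms by (intro schatten_norm_sum_diff) auto
  have MZ: "M = ?S Z"
    using M[OF U diag] by (simp add: Z_def)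
  have L: "L = ?S (aligned Z)"
    unfolding L_def \<sigma> al using len \<open>1 \<le> p\<close> by (intro lp_norm_sum_diff) auto
  have R: "R = ?S (antialigned Z)"
    unfolding R_def \<sigma> anti using len \<open>1 \<le> p\<close> by (intro lp_norm_sum_diff) auto
  have neg: "(\<Sum>(x, y)\<in>#W. - sum_diff_powr p x y) = - ?S W" for W
    by (induction W) auto
  have weak: "(p \<le> 2 \<longrightarrow> L \<le> M \<and> M \<le> R) \<and> (2 \<le> p \<longrightarrow> R \<le> M \<and> M \<le> L)"
  proof (intro conjI impI)
    assume "p \<le> 2"
    note sm = supermodular_sum_diff_powr(1)[OF \<open>1 \<le> p\<close> this]
    show "L \<le> M" "M \<le> R"
      using sum_le_sum_aligned[OF sm Z_nonneg] sum_le_sum_antialigned[OF sm Z_nonneg]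
      by (simp_all add: neg MZ L R)
  next
    assume "2 \<le> p"
    note sm = supermodular_sum_diff_powr(2)[OF \<open>1 \<le> p\<close> this]
    show "M \<le> L"
      using sum_le_sum_aligned[OF sm Z_nonneg] by (simp add: MZ L)
    \<comment> \<open>The antialigned bound is applied to the negated function, which reverses the
      inequality between the sums.\<close>
    show "R \<le> M"
      using sum_le_sum_antialigned[of _ _ "\<lambda>x y. - sum_diff_powr p x y", OF _ Z_nonneg] sm
      by (simp add: neg MZ R)
  qed
  have strict: "(Z \<noteq> aligned Z \<longrightarrow> L \<noteq> M) \<and> (Z \<noteq> antialigned Z \<longrightarrow> M \<noteq> R)" if "p \<noteq> 1" "p \<noteq> 2"
  proof (cases "p < 2")
    case True
    then have ssm: "strict_supermodular_on {0..} {0..} (\<lambda>x y. - sum_diff_powr p x y)"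
      using that \<open>1 \<le> p\<close> by (intro strict_supermodular_sum_diff_powr) auto
    note sm = strict_supermodular_on_imp_supermodular_on[OF ssm]
    show ?thesis
      using sum_less_sum_aligned[OF sm Z_nonneg ssm] sum_less_sum_antialigned[OF sm Z_nonneg ssm]
      by (auto simp: neg MZ L R)
  next
    case False
    then have ssm: "strict_supermodular_on {0..} {0..} (sum_diff_powr p)"
      using that \<open>1 \<le> p\<close> by (intro strict_supermodular_sum_diff_powr) auto
    note sm = strict_supermodular_on_imp_supermodular_on[OF ssm]
    show ?thesis
      using sum_less_sum_aligned[OF sm Z_nonneg ssm] ssm sm
        sum_less_sum_antialigned[of _ _ "\<lambda>x y. - sum_diff_powr p x y", OF _ Z_nonneg]
      by (auto simp: neg MZ L R)
  qed
  have "simultaneously_aligned n A B (\<sigma>\<^sub>\<down> A) (\<sigma>\<^sub>\<down> B)" if "Z = aligned Z"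
    unfolding \<sigma> by (rule simultaneously_alignedI[OF U A B diag _ _ trans[OF Z_def[symmetric] trans[OF that al]]])
      (simp_all add: len)
  moreover have "simultaneously_aligned n A B (\<sigma>\<^sub>\<up> A) (\<sigma>\<^sub>\<down> B)" if "Z = antialigned Z"
    unfolding \<sigma> by (rule simultaneously_alignedI[OF U A B diag _ _ trans[OF Z_def[symmetric] trans[OF that anti]]])
      (simp_all add: len)
  \<comment> \<open>In the aligning basis the pairs are already the extremal ones, so the two sums
    coincide term by term.\<close>
  moreover have "L = M" if "simultaneously_aligned n A B (\<sigma>\<^sub>\<down> A) (\<sigma>\<^sub>\<down> B)"
    using that M len unfolding \<sigma> by (subst (asm) simultaneously_aligned_iff) (auto simp: L al)
  moreover have "M = R" if "simultaneously_aligned n A B (\<sigma>\<^sub>\<up> A) (\<sigma>\<^sub>\<down> B)"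
    using that M len unfolding \<sigma> by (subst (asm) simultaneously_aligned_iff) (auto simp: R anti)
  ultimately have "(L = M \<longleftrightarrow> simultaneously_aligned n A B (\<sigma>\<^sub>\<down> A) (\<sigma>\<^sub>\<down> B)) \<and>
      (M = R \<longleftrightarrow> simultaneously_aligned n A B (\<sigma>\<^sub>\<up> A) (\<sigma>\<^sub>\<down> B))" if "p \<noteq> 1" "p \<noteq> 2"
    using strict[OF that] by blast
  then show ?thesis
    using weak by simp
qed

end
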